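(* Let $G$ be a finite group and $g\in G'$. If $H$ and $K$ are any two subgroups of $G$, then $$\Pr\nolimits_g(H,K)\le\Pr(H,K)$$ with equality if and only if $g=1$.
   Context: $G'$ is the commutator subgroup; $[x,y]=xyx^{-1}y^{-1}$; $\Pr_g(H,K)=|\{(x,y)\in H\times K:[x,y]=g\}|/(|H||K|)$ and $\Pr(H,K)=\Pr_1(H,K)=|\{(x,y)\in H\times K:xy=yx\}|/(|H||K|)$. *)

theory Defs
  imports Complex_Main "HOL-Algebra.Generated_Groups"
begin

definition commutator :: "('a, 'b) monoid_scheme \<Rightarrow> 'a \<Rightarrow> 'a \<Rightarrow> 'a" where
  "commutator G x y = x \<otimes>\<^bsub>G\<^esub> y \<otimes>\<^bsub>G\<^esub> inv\<^bsub>G\<^esub> x \<otimes>\<^bsub>G\<^esub> inv\<^bsub>G\<^esub> y"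

definition commutator_prob ::
    "('a, 'b) monoid_scheme \<Rightarrow> 'a \<Rightarrow> 'a set \<Rightarrow> 'a set \<Rightarrow> real" where
  "commutator_prob G g H K =
     real (card {(x, y) \<in> H \<times> K. commutator G x y = g}) / (real (card H) * real (card K))"

definition commuting_prob :: "('a, 'b) monoid_scheme \<Rightarrow> 'a set \<Rightarrow> 'a set \<Rightarrow> real" where
  "commuting_prob G H K =
     real (card {(x, y) \<in> H \<times> K. x \<otimes>\<^bsub>G\<^esub> y = y \<otimes>\<^bsub>G\<^esub> x}) / (real (card H) * real (card K))"

lemma (in group) commutator_eq_one_iff:
  assumes "x \<in> carrier G" "y \<in> carrier G"
  shows "commutator G x y = \<one> \<longleftrightarrow> x \<otimes> y = y \<otimes> x"
proof -
  have "commutator G x y = (x \<otimes> y) \<otimes> inv (y \<otimes> x)"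
    using assms by (simp add: commutator_def inv_mult_group m_assoc)
  then show ?thesis
    using assms by (metis inv_closed inv_equality inv_inv m_closed r_inv)
qed

lemma (in group) commuting_prob_eq_commutator_prob_one:
  assumes "H \<subseteq> carrier G" "K \<subseteq> carrier G"
  shows "commuting_prob G H K = commutator_prob G \<one> H K"
proof -
  have "{(x, y) \<in> H \<times> K. x \<otimes> y = y \<otimes> x} = {(x, y) \<in> H \<times> K. commutator G x y = \<one>}"
    using assms commutator_eq_one_iff by blast
  then show ?thesis
    by (simp add: commuting_prob_def commutator_prob_def)
qed

end

theory Submission
  imports Defs
begin

text \<open>
  Count the pairs one \<open>x \<in> H\<close> at a time. If \<open>[x, y] = g\<close> and \<open>[x, z] = g\<close>, then \<open>y\<close> and \<open>z\<close>
  conjugate \<open>x\<inverse>\<close> to the same element \<open>x\<inverse> g\<close>, so \<open>y\<inverse> z\<close> commutes with \<open>x\<close>. Translating by a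
  fixed solution \<open>y\<^sub>0 \<in> K\<close> therefore embeds the solutions of \<open>[x, y] = g\<close> in \<open>K\<close> into the centralizer
  of \<open>x\<close> in \<open>K\<close> (lemma \<open>card_commutator_fibre_le\<close>), and summing over \<open>x \<in> H\<close> gives the inequality.
  For \<open>g \<noteq> 1\<close> the fibre at \<open>x = 1\<close> makes it strict: \<open>[1, y] = g\<close> has no solution, whereas every
  element of \<open>K\<close> commutes with \<open>1\<close>.
\<close>

context group
begin

lemma commutator_one_left:
  assumes "y \<in> carrier G"
  shows "commutator G \<one> y = \<one>"
  using assms by (simp add: commutator_def)

lemma commute_of_commutator_eq:
  assumes x: "x \<in> carrier G" and y: "y \<in> carrier G" and z: "z \<in> carrier G"
    and eq: "commutator G x y = commutator G x z"
  shows "x \<otimes> (inv y \<otimes> z) = (inv y \<otimes> z) \<otimes> x"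
proof -
  have "x \<otimes> (y \<otimes> inv x \<otimes> inv y) = x \<otimes> (z \<otimes> inv x \<otimes> inv z)"
    using eq x y z by (simp add: commutator_def m_assoc)
  then have conj: "y \<otimes> inv x \<otimes> inv y = z \<otimes> inv x \<otimes> inv z"
    using x y z by simp
  define w where "w = inv y \<otimes> z"
  have w: "w \<in> carrier G" and z_eq: "z = y \<otimes> w"
    using y z by (simp_all add: w_def flip: m_assoc)
  have "y \<otimes> (inv x \<otimes> inv y) = y \<otimes> (w \<otimes> inv x \<otimes> inv w \<otimes> inv y)"
    using conj x y w by (simp add: z_eq m_assoc inv_mult_group)
  then have "inv x = w \<otimes> inv x \<otimes> inv w"
    using x y w by simp
  then have "inv x \<otimes> w = w \<otimes> inv x \<otimes> inv w \<otimes> w"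
    by simp
  also have "\<dots> = w \<otimes> inv x"
    using x w by (simp add: m_assoc)
  finally have inv_comm: "inv x \<otimes> w = w \<otimes> inv x" .
  have "x \<otimes> w = x \<otimes> (w \<otimes> inv x) \<otimes> x"
    using x w by (simp add: m_assoc)
  also have "\<dots> = x \<otimes> (inv x \<otimes> w) \<otimes> x"
    by (simp only: inv_comm)
  also have "\<dots> = w \<otimes> x"
    using x w by (simp flip: m_assoc)
  finally show ?thesis
    by (simp add: w_def)
qed

lemma card_commutator_fibre_le:
  assumes x: "x \<in> carrier G" and K: "subgroup K G" and fin: "finite K"
  shows "card {y \<in> K. commutator G x y = g} \<le> card {y \<in> K. x \<otimes> y = y \<otimes> x}"
proof (cases "{y \<in> K. commutator G x y = g} = {}")
  case True
  then show ?thesis by (simp only: card.empty le0)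
next
  case False
  then obtain y0 where y0: "y0 \<in> K" "commutator G x y0 = g" by blast
  note carr = subgroup.mem_carrier[OF K]
  show ?thesis
  proof (rule card_inj_on_le[where f = "\<lambda>y. inv y0 \<otimes> y"])
    have y0_carr: "y0 \<in> carrier G"
      using carr y0(1) .
    show "inj_on (\<lambda>y. inv y0 \<otimes> y) {y \<in> K. commutator G x y = g}"
    proof (rule inj_onI)
      fix y z
      assume "y \<in> {y \<in> K. commutator G x y = g}" "z \<in> {y \<in> K. commutator G x y = g}"
        and eq: "inv y0 \<otimes> y = inv y0 \<otimes> z"
      then have "y \<in> carrier G" "z \<in> carrier G"
        by (blast intro: carr)+
      then show "y = z"
        using eq y0_carr by simp
    qed
    show "(\<lambda>y. inv y0 \<otimes> y) ` {y \<in> K. commutator G x y = g} \<subseteq> {y \<in> K. x \<otimes> y = y \<otimes> x}"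
    proof (rule image_subsetI)
      fix y
      assume "y \<in> {y \<in> K. commutator G x y = g}"
      then have yK: "y \<in> K" and y: "commutator G x y0 = commutator G x y"
        using y0(2) by simp_all
      have "inv y0 \<otimes> y \<in> K"
        by (rule subgroup.m_closed[OF K subgroup.m_inv_closed[OF K y0(1)] yK])
      moreover have "x \<otimes> (inv y0 \<otimes> y) = (inv y0 \<otimes> y) \<otimes> x"
        by (rule commute_of_commutator_eq[OF x y0_carr carr[OF yK] y])
      ultimately show "inv y0 \<otimes> y \<in> {y \<in> K. x \<otimes> y = y \<otimes> x}"
        by blast
    qed
    show "finite {y \<in> K. x \<otimes> y = y \<otimes> x}"
      using fin by simp
  qed
qed

lemma card_commutator_fibre_less_at_one:
  assumes K: "subgroup K G" and fin: "finite K" and "g \<noteq> \<one>"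
  shows "card {y \<in> K. commutator G \<one> y = g} < card {y \<in> K. \<one> \<otimes> y = y \<otimes> \<one>}"
proof -
  note carr = subgroup.mem_carrier[OF K]
  have "{y \<in> K. commutator G \<one> y = g} = {}"
    using carr assms(3) by (auto simp: commutator_one_left)
  moreover have "\<one> \<in> {y \<in> K. \<one> \<otimes> y = y \<otimes> \<one>}"
    using subgroup.one_closed[OF K] by simp
  moreover have "finite {y \<in> K. \<one> \<otimes> y = y \<otimes> \<one>}"
    using fin by simp
  ultimately show ?thesis
    by (metis card.empty card_gt_0_iff empty_iff)
qed

end

lemma card_Collect_pairs:
  assumes "finite A" "finite B"
  shows "card {(x, y) \<in> A \<times> B. P x y} = (\<Sum>x\<in>A. card {y \<in> B. P x y})"
proof -
  have "{(x, y) \<in> A \<times> B. P x y} = (SIGMA x:A. {y \<in> B. P x y})"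
    by auto
  then show ?thesis
    using assms by (simp add: card_SigmaI)
qed

theorem proposition5p2p2:
  fixes G (structure) and g :: 'a and H K :: "'a set"
  assumes "group G"
    and "finite (carrier G)"
    and "g \<in> derived G (carrier G)"
    and "subgroup H G"
    and "subgroup K G"
  shows "commutator_prob G g H K \<le> commuting_prob G H K \<and>
    (commutator_prob G g H K = commuting_prob G H K \<longleftrightarrow> g = \<one>)"
proof -
  interpret group G by fact
  note subH = subgroup.subset[OF assms(4)]
  note subK = subgroup.subset[OF assms(5)]
  have finH: "finite H" and finK: "finite K"
    using subH subK assms(2) finite_subset by blast+
  have oneH: "\<one> \<in> H" and oneK: "\<one> \<in> K"
    using assms(4,5) subgroup.one_closed by auto
  have "0 < card H" and "0 < card K"
    using finH finK oneH oneK by (auto simp: card_gt_0_iff)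
  then have pos: "0 < real (card H) * real (card K)"
    by simp
  have fibre: "card {y \<in> K. commutator G x y = g} \<le> card {y \<in> K. x \<otimes> y = y \<otimes> x}"
    if "x \<in> H" for x
    using that subH finK assms(5) by (intro card_commutator_fibre_le) auto
  have "card {(x, y) \<in> H \<times> K. commutator G x y = g}
      \<le> card {(x, y) \<in> H \<times> K. x \<otimes> y = y \<otimes> x}"
    unfolding card_Collect_pairs[OF finH finK] by (intro sum_mono fibre)
  then have le: "commutator_prob G g H K \<le> commuting_prob G H K"
    unfolding commutator_prob_def commuting_prob_def
    using pos by (intro divide_right_mono) auto
  have less: "commutator_prob G g H K < commuting_prob G H K" if "g \<noteq> \<one>"
  proof -
    have "card {(x, y) \<in> H \<times> K. commutator G x y = g}
        < card {(x, y) \<in> H \<times> K. x \<otimes> y = y \<otimes> x}"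
      unfolding card_Collect_pairs[OF finH finK]
    proof (rule sum_strict_mono_ex1[OF finH])
      show "\<forall>x\<in>H. card {y \<in> K. commutator G x y = g} \<le> card {y \<in> K. x \<otimes> y = y \<otimes> x}"
        using fibre by blast
      show "\<exists>x\<in>H. card {y \<in> K. commutator G x y = g} < card {y \<in> K. x \<otimes> y = y \<otimes> x}"
        using oneH card_commutator_fibre_less_at_one[OF assms(5) finK that] by (rule bexI[rotated])
    qed
    then show ?thesis
      unfolding commutator_prob_def commuting_prob_def
      using pos by (intro divide_strict_right_mono) auto
  qed
  have "commutator_prob G \<one> H K = commuting_prob G H K"
    using commuting_prob_eq_commutator_prob_one[OF subH subK] by simp
  with le less show ?thesis
    by (metis less_irrefl)
qed

end
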